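(* Let $\mathcal{S}=\mathbb{N}$, let $\mathcal{F}$ be the family of all infinite subsets of $\mathbb{N}$, and let $\mathcal{A}$, $\mathcal{A}_1$, $\{p_\alpha\}_\alpha$, $\Phi_n$, $b_n$, $T_n$, $S_n$, $C_n$ ($n\in\mathbb{N}$) be as in the context and satisfy all the assumptions listed there. Suppose that there exist dense subsets $\mathcal{B}_1,\mathcal{B}_2$ of $\mathcal{A}$ and a strictly increasing sequence $\{n_k\}_k\subseteq\mathbb{N}$ such that either, for all $x\in\mathcal{B}_1$ and $y\in\mathcal{B}_2$, $$\lim_{k\to\infty}\|\Phi_{n_k}^{-2}(b_{n_k})\,\Phi_{n_k}^{-1}(b_{n_k})\,y\|=\lim_{k\to\infty}\|b_{n_k}^{-1}x\|\,\|\Phi_{n_k}^{-1}(b_{n_k})\,y\|=\lim_{k\to\infty}\|\Phi_{n_k}^{-1}(b_{n_k})\,x\|\,\|\Phi_{n_k}^{-1}(b_{n_k})\,y\|=0,$$ or, for all $x\in\mathcal{B}_1$ and $y\in\mathcal{B}_2$, $$\lim_{k\to\infty}\|\Phi_{n_k}(b_{n_k}^{-1})\,b_{n_k}^{-1}\,y\|=\lim_{k\to\infty}\|b_{n_k}^{-1}x\|\,\|b_{n_k}^{-1}y\|=\lim_{k\to\infty}\|\Phi_{n_k}^{-1}(b_{n_k})\,x\|\,\|b_{n_k}^{-1}y\|=0 .$$ Then the family $\{C_n\}_{n\in\mathbb{N}}$ is $\mathcal{F}$-semi-transitive on $\mathcal{A}$.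
   Context: Setting and standing assumptions (with index set $\mathcal{S}=\mathbb{N}$). - $\mathcal{A}$ is a non-unital normed algebra with norm $\|\cdot\|$, which is a left ideal in a unital normed algebra $\mathcal{A}_1$ with norm $\|\cdot\|_1$. The norm of $\mathcal{A}$ is not assumed to extend to $\mathcal{A}_1$. It is assumed that $\|ba\|\le\|b\|_1\|a\|$ for all $a\in\mathcal{A}$, $b\in\mathcal{A}_1$. - $\{p_\alpha\}_\alpha$ is a set of elements of $\mathcal{A}$ such that for every open subset $O$ of $\mathcal{A}$ and every $x\in O$ there is some $p_{\alpha_0}\in\{p_\alpha\}_\alpha$ with $p_{\alpha_0}^3x\in O$. - For each $t\in\mathcal{S}$, $\Phi_t$ is an isometric algebra isomorphism of $\mathcal{A}_1$ onto itself with $\Phi_t(\mathcal{A})=\mathcal{A}$ and such that the restriction of $\Phi_t$ to $\mathcal{A}$ is an isometry for $\|\cdot\|$. We write $\Phi_t^{-2}=\Phi_t^{-1}\circ\Phi_t^{-1}$. - Aperiodicity with respect to $\{p_\alpha\}_\alpha$: for each $p_\alpha$ and every $H\in\mathcal{F}$ there is some $F\in\mathcal{F}$ with $F\subseteq H$ such that $p_\alpha\Phi_t(p_\alpha)=0$ and $p_\alpha\Phi_t^{-1}(p_\alpha)=0$ for all $t\in F$. - For each $\alpha$, all $t\in\mathcal{S}$ and $a\in\mathcal{A}$: $\|ap_\alpha\|\le\|a\|$, $\|a\Phi_t(p_\alpha)\|\le\|a\|$, $\|a\Phi_t^{-1}(p_\alpha)\|\le\|a\|$. - For each $t\in\mathcal{S}$,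 $b_t$ is an invertible element of $\mathcal{A}_1$ with inverse $b_t^{-1}\in\mathcal{A}_1$; $T_t:\mathcal{A}\to\mathcal{A}$ is the bounded linear operator $T_t(a)=b_t\,\Phi_t(a)$; $S_t:\mathcal{A}\to\mathcal{A}$ is $S_t(a)=\Phi_t^{-1}(b_t^{-1})\,\Phi_t^{-1}(a)$, so that $S_t=T_t^{-1}$; and $C_t:=\tfrac12(T_t+S_t)$. Definition. A family $\{C_t\}_{t\in\mathcal{S}}$ of bounded linear operators on a normed space $X$ is $\mathcal{F}$-semi-transitive if for all non-empty open subsets $\mathcal{O},V$ of $X$ there is some $F\in\mathcal{F}$ such that for every $t\in F$ there is a real $\lambda_t>0$ with $\mathcal{O}\cap\lambda_tC_t^{-1}(V)\neq\varnothing$, where $C_t^{-1}(V)$ denotes the preimage. *)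

theory Defs
  imports "HOL-Analysis.Analysis"
begin

text \<open>
  The unital algebra \<open>A\<^sub>1\<close> is a type of sort \<open>{real_algebra_1, real_normed_algebra}\<close>: its norm is
  submultiplicative, but the unit is not required to have norm \<open>1\<close>.  Since \<open>A\<close> carries a norm of its
  own, it is a second type of class \<open>real_normed_algebra\<close>, identified with a left ideal of \<open>A\<^sub>1\<close>
  by an injective algebra homomorphism \<open>\<iota>\<close> on which no relation between the two norms is imposed.
  Complex algebras and their isomorphisms are covered by restriction of scalars.
\<close>

definition left_ideal_embedding ::
    "('a::real_normed_algebra \<Rightarrow> 'b::{real_algebra_1, real_normed_algebra}) \<Rightarrow> bool" where
  "left_ideal_embedding \<iota> \<longleftrightarrow>
     linear \<iota> \<and> inj \<iota> \<and> (\<forall>x y. \<iota> (x * y) = \<iota> x * \<iota> y) \<and> (\<forall>c a. c * \<iota> a \<in> range \<iota>)"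

text \<open>
  The product \<open>c a \<in> A\<close> of \<open>c \<in> A\<^sub>1\<close> and \<open>a \<in> A\<close>, and the restriction to \<open>A\<close> of a map of \<open>A\<^sub>1\<close>
  preserving \<open>A\<close>; see the lemmas \<open>\<iota>_ideal_mult\<close> and \<open>\<iota>_restrict_to\<close>.
\<close>

definition ideal_mult ::
    "('a::real_normed_algebra \<Rightarrow> 'b::{real_algebra_1, real_normed_algebra}) \<Rightarrow> 'b \<Rightarrow> 'a \<Rightarrow> 'a" where
  "ideal_mult \<iota> c a = inv \<iota> (c * \<iota> a)"

definition restrict_to :: "('a \<Rightarrow> 'b) \<Rightarrow> ('b \<Rightarrow> 'b) \<Rightarrow> 'a \<Rightarrow> 'a" where
  "restrict_to \<iota> f a = inv \<iota> (f (\<iota> a))"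

lemma \<iota>_ideal_mult:
  "left_ideal_embedding \<iota> \<Longrightarrow> \<iota> (ideal_mult \<iota> c a) = c * \<iota> a"
  by (simp add: left_ideal_embedding_def ideal_mult_def f_inv_into_f)

lemma \<iota>_restrict_to:
  "f ` range \<iota> \<subseteq> range \<iota> \<Longrightarrow> \<iota> (restrict_to \<iota> f a) = f (\<iota> a)"
  by (simp add: restrict_to_def f_inv_into_f image_subset_iff)

definition isometric_algebra_iso :: "('b::real_normed_algebra \<Rightarrow> 'b) \<Rightarrow> bool" where
  "isometric_algebra_iso f \<longleftrightarrow>
     linear f \<and> bij f \<and> (\<forall>x y. f (x * y) = f x * f y) \<and> (\<forall>x. norm (f x) = norm x)"

text \<open>Here \<open>\<phi> t\<close> and \<open>\<psi> t\<close> stand for the restrictions of \<open>\<Phi>\<^sub>t\<close> and of its inverse to \<open>A\<close>.\<close>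

definition aperiodic_wrt ::
    "'t set set \<Rightarrow> 'a::real_normed_algebra set \<Rightarrow> ('t \<Rightarrow> 'a \<Rightarrow> 'a) \<Rightarrow> ('t \<Rightarrow> 'a \<Rightarrow> 'a) \<Rightarrow> bool" where
  "aperiodic_wrt \<F> P \<phi> \<psi> \<longleftrightarrow>
     (\<forall>p\<in>P. \<forall>H\<in>\<F>. \<exists>F\<in>\<F>. F \<subseteq> H \<and> (\<forall>t\<in>F. p * \<phi> t p = 0 \<and> p * \<psi> t p = 0))"

definition T_op ::
    "('a::real_normed_algebra \<Rightarrow> 'b::{real_algebra_1, real_normed_algebra}) \<Rightarrow> ('t \<Rightarrow> 'b \<Rightarrow> 'b) \<Rightarrow> ('t \<Rightarrow> 'b)
      \<Rightarrow> 't \<Rightarrow> 'a \<Rightarrow> 'a" where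
  "T_op \<iota> \<Phi> b t a = ideal_mult \<iota> (b t) (restrict_to \<iota> (\<Phi> t) a)"

text \<open>Below, \<open>b'\<close> is the family of inverses of the \<open>b t\<close>.\<close>

definition S_op ::
    "('a::real_normed_algebra \<Rightarrow> 'b::{real_algebra_1, real_normed_algebra}) \<Rightarrow> ('t \<Rightarrow> 'b \<Rightarrow> 'b) \<Rightarrow> ('t \<Rightarrow> 'b)
      \<Rightarrow> 't \<Rightarrow> 'a \<Rightarrow> 'a" where
  "S_op \<iota> \<Phi> b' t a = ideal_mult \<iota> (inv (\<Phi> t) (b' t)) (restrict_to \<iota> (inv (\<Phi> t)) a)"

definition C_op ::
    "('a::real_normed_algebra \<Rightarrow> 'b::{real_algebra_1, real_normed_algebra}) \<Rightarrow> ('t \<Rightarrow> 'b \<Rightarrow> 'b) \<Rightarrow> ('t \<Rightarrow> 'b)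
      \<Rightarrow> ('t \<Rightarrow> 'b) \<Rightarrow> 't \<Rightarrow> 'a \<Rightarrow> 'a" where
  "C_op \<iota> \<Phi> b b' t a = (1/2) *\<^sub>R (T_op \<iota> \<Phi> b t a + S_op \<iota> \<Phi> b' t a)"

text \<open>
  The first conjunct records that the notion is one for families of bounded linear operators;
  \<open>C t -` V\<close> is the preimage, so \<open>C t\<close> need not be invertible.
\<close>

definition semi_transitive ::
    "'t set set \<Rightarrow> ('t \<Rightarrow> 'x \<Rightarrow> 'x::real_normed_vector) \<Rightarrow> bool" where
  "semi_transitive \<F> C \<longleftrightarrow>
     (\<forall>t. bounded_linear (C t)) \<and>
     (\<forall>U V. open U \<and> U \<noteq> {} \<and> open V \<and> V \<noteq> {} \<longrightarrow>
        (\<exists>F\<in>\<F>. \<forall>t\<in>F. \<exists>l>0. U \<inter> (\<lambda>v. l *\<^sub>R v) ` (C t -` V) \<noteq> {}))"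

end

theory Submission
  imports Defs
begin

text \<open>
  Isometry of the automorphisms turns every norm in the limit hypotheses into a norm of an orbit
  under \<open>T\<close> or \<open>S\<close>: with \<open>t = n k\<close>, the first alternative says that \<open>\<parallel>T\<^sub>t (T\<^sub>t y)\<parallel>\<close>,
  \<open>\<parallel>S\<^sub>t x\<parallel> \<parallel>T\<^sub>t y\<parallel>\<close> and \<open>\<parallel>T\<^sub>t x\<parallel> \<parallel>T\<^sub>t y\<parallel>\<close> tend to \<open>0\<close>, and the second says the same with \<open>T\<close> and \<open>S\<close>
  exchanged (\<open>norm_twist\<close>, \<open>norm_twist_twice\<close>).  Since \<open>S\<^sub>t\<close> and \<open>T\<^sub>t\<close> are mutually inverse and
  \<open>C\<^sub>t\<close> is symmetric in them, one argument serves both alternatives.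

  Given \<open>x \<in> U\<close> and \<open>y \<in> V\<close> from the dense sets, perturb \<open>x\<close> to \<open>u = x + 2 l T\<^sub>t y\<close>.  As \<open>S\<^sub>t T\<^sub>t y = y\<close>,
  \<open>l\<^sup>-\<^sup>1 C\<^sub>t u = y + T\<^sub>t T\<^sub>t y + l\<^sup>-\<^sup>1 C\<^sub>t x\<close>, so that \<open>u \<in> U\<close> and \<open>l\<^sup>-\<^sup>1 C\<^sub>t u \<in> V\<close> as soon as \<open>l \<parallel>T\<^sub>t y\<parallel>\<close>, \<open>(\<parallel>T\<^sub>t x\<parallel> + \<parallel>S\<^sub>t x\<parallel>) / l\<close> and
  \<open>\<parallel>T\<^sub>t T\<^sub>t y\<parallel>\<close> are small.  A scale \<open>l\<close> making the first two small exists because their product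
  tends to \<open>0\<close> (\<open>exists_balancing_scale\<close>).
\<close>

section \<open>Averages of an operator and its inverse\<close>

text \<open>
  Any \<open>l\<close> strictly between \<open>a / e\<close> and \<open>e / c\<close> balances the two errors.  For \<open>c = 0\<close> there is no upper
  constraint, but the quotient \<open>e / c\<close> is then \<open>0\<close>, hence the case distinction.
\<close>

lemma exists_balancing_scale:
  fixes a c e :: real
  assumes "0 \<le> a" "0 \<le> c" "0 < e" "a * c < e * e"
  shows "\<exists>l>0. l * c < e \<and> a / l < e"
proof (cases "c = 0")
  case True
  have "0 < a / e + 1" "a / (a / e + 1) < e"
    using assms by (auto simp: field_simps add_pos_nonneg add_nonneg_pos)
  with True \<open>0 < e\<close> show ?thesis by (intro exI[of _ "a / e + 1"]) auto
next
  case False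
  with assms have "a / e < e / c" by (simp add: field_simps)
  then obtain l where l: "a / e < l" "l < e / c" using dense by blast
  have "0 \<le> a / e" using assms by simp
  with l have "0 < l" by linarith
  with l False assms show ?thesis by (intro exI[of _ l]) (auto simp: field_simps)
qed

text \<open>
  The hypotheses favour \<open>T\<close>, since the perturbation of \<open>x\<close> lies along \<open>T\<^sub>t y\<close>; the average does not, so
  the lemma may also be used with \<open>T\<close> and \<open>S\<close> exchanged when \<open>T\<^sub>t S\<^sub>t = id\<close>.
\<close>

lemma semi_transitive_average:
  fixes T S :: "nat \<Rightarrow> 'x::real_normed_vector \<Rightarrow> 'x"
  assumes T: "\<And>t. bounded_linear (T t)" and S: "\<And>t. bounded_linear (S t)"
    and left_inverse: "\<And>t x. S t (T t x) = x"
    and dense: "closure B1 = UNIV" "closure B2 = UNIV"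
    and subseq: "strict_mono n"
    and TT: "\<And>y. y \<in> B2 \<Longrightarrow> (\<lambda>k. norm (T (n k) (T (n k) y))) \<longlonglongrightarrow> 0"
    and ST: "\<And>x y. x \<in> B1 \<Longrightarrow> y \<in> B2 \<Longrightarrow> (\<lambda>k. norm (S (n k) x) * norm (T (n k) y)) \<longlonglongrightarrow> 0"
    and TxT: "\<And>x y. x \<in> B1 \<Longrightarrow> y \<in> B2 \<Longrightarrow> (\<lambda>k. norm (T (n k) x) * norm (T (n k) y)) \<longlonglongrightarrow> 0"
  shows "semi_transitive {F. infinite F} (\<lambda>t a. (1/2) *\<^sub>R (T t a + S t a))"
  unfolding semi_transitive_def
proof (intro conjI allI impI)
  show "bounded_linear (\<lambda>a. (1/2) *\<^sub>R (T t a + S t a))" for t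
    using bounded_linear_add[OF T S] by (rule bounded_linear_const_scaleR)
next
  fix U V :: "'x set"
  assume "open U \<and> U \<noteq> {} \<and> open V \<and> V \<noteq> {}"
  then have UV: "open U" "U \<noteq> {}" "open V" "V \<noteq> {}" by auto
  obtain x where x: "x \<in> B1" "x \<in> U"
    using open_Int_closure_eq_empty[OF UV(1), of B1] UV(2) dense(1) by auto
  obtain y where y: "y \<in> B2" "y \<in> V"
    using open_Int_closure_eq_empty[OF UV(3), of B2] UV(4) dense(2) by auto
  obtain d1 where d1: "d1 > 0" "\<And>z. dist z x < d1 \<Longrightarrow> z \<in> U"
    using UV(1) x(2) unfolding open_dist by blast
  obtain d2 where d2: "d2 > 0" "\<And>z. dist z y < d2 \<Longrightarrow> z \<in> V"
    using UV(3) y(2) unfolding open_dist by blast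
  define e where "e = min d1 d2 / 2"
  have e: "e > 0" "2 * e \<le> d1" "2 * e \<le> d2" using d1(1) d2(1) by (auto simp: e_def)
  define a where "a t = norm (T t x) + norm (S t x)" for t
  have "(\<lambda>k. a (n k) * norm (T (n k) y)) \<longlonglongrightarrow> 0"
    using tendsto_add[OF TxT[OF x(1) y(1)] ST[OF x(1) y(1)]] by (simp add: a_def ring_distribs)
  then have "\<forall>\<^sub>F k in sequentially. a (n k) * norm (T (n k) y) < e * e"
    by (rule order_tendstoD) (use e in simp)
  moreover have "\<forall>\<^sub>F k in sequentially. norm (T (n k) (T (n k) y)) < e"
    using order_tendstoD(2)[OF TT[OF y(1)] e(1)] .
  ultimately have "\<forall>\<^sub>F k in sequentially.
      a (n k) * norm (T (n k) y) < e * e \<and> norm (T (n k) (T (n k) y)) < e"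
    by (rule eventually_conj)
  then obtain K where K: "\<And>k. k \<ge> K \<Longrightarrow>
      a (n k) * norm (T (n k) y) < e * e \<and> norm (T (n k) (T (n k) y)) < e"
    unfolding eventually_sequentially by blast
  let ?C = "\<lambda>t a. (1/2) *\<^sub>R (T t a + S t a)"
  have "\<exists>l>0. U \<inter> (\<lambda>v. l *\<^sub>R v) ` (?C t -` V) \<noteq> {}" if "t \<in> n ` {K..}" for t
  proof -
    interpret T: bounded_linear "T t" by (rule T)
    interpret S: bounded_linear "S t" by (rule S)
    have small: "a t * norm (T t y) < e * e" "norm (T t (T t y)) < e" using K that by auto
    obtain l where l: "l > 0" "l * norm (T t y) < e" "a t / l < e"
      using exists_balancing_scale[of "a t" "norm (T t y)" e] e(1) small(1)
      by (auto simp: a_def)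
    \<comment> \<open>\<open>v\<close> is the perturbation of \<open>x\<close> by \<open>2 l T\<^sub>t y\<close>, already divided by \<open>l\<close>.\<close>
    define v where "v = (1/l) *\<^sub>R x + 2 *\<^sub>R T t y"
    have lv: "l *\<^sub>R v = x + (2 * l) *\<^sub>R T t y"
      using l(1) by (simp add: v_def scaleR_add_right)
    have "norm ((2 * l) *\<^sub>R T t y) < d1" using l e by simp
    then have "l *\<^sub>R v \<in> U" by (intro d1(2)) (simp add: lv dist_norm)
    have "?C t v - y = T t (T t y) + (1 / (2 * l)) *\<^sub>R (T t x + S t x)"
      by (simp add: v_def T.add T.scaleR S.add S.scaleR left_inverse algebra_simps)
    also have "norm \<dots> \<le> norm (T t (T t y)) + norm ((1 / (2 * l)) *\<^sub>R (T t x + S t x))"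
      by (rule norm_triangle_ineq)
    also have "norm ((1 / (2 * l)) *\<^sub>R (T t x + S t x)) \<le> (1 / l) * a t"
      unfolding norm_scaleR
      by (rule mult_mono) (use l(1) norm_triangle_ineq in \<open>auto simp: a_def field_simps\<close>)
    finally have "norm (?C t v - y) < d2" using small(2) l(3) e by simp
    then have "?C t v \<in> V" by (intro d2(2)) (simp add: dist_norm)
    with \<open>l *\<^sub>R v \<in> U\<close> l(1) show ?thesis by blast
  qed
  moreover have "infinite (n ` {K..})"
    using subseq by (simp add: finite_image_iff strict_mono_imp_inj_on inj_on_subset infinite_Ici)
  ultimately show "\<exists>F\<in>{F. infinite F}. \<forall>t\<in>F. \<exists>l>0. U \<inter> (\<lambda>v. l *\<^sub>R v) ` (?C t -` V) \<noteq> {}"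
    by blast
qed

section \<open>Automorphisms preserving a left ideal\<close>

locale ideal_automorphism =
  fixes \<iota> :: "'a::real_normed_algebra \<Rightarrow> 'b::{real_algebra_1, real_normed_algebra}"
    and f :: "'b \<Rightarrow> 'b"
  assumes ideal: "left_ideal_embedding \<iota>"
    and norm_ideal_mult: "norm (ideal_mult \<iota> c a) \<le> norm c * norm a"
    and iso: "isometric_algebra_iso f"
    and preserves: "f ` range \<iota> = range \<iota>"
    and isometry: "norm (restrict_to \<iota> f a) = norm a"
begin

lemma bij: "bij f" and linear: "linear f" and mult: "f (c * d) = f c * f d"
  using iso by (auto simp: isometric_algebra_iso_def)

lemma inv_f [simp]: "inv f (f c) = c" and f_inv [simp]: "f (inv f c) = c"
  using bij by (auto simp: bij_is_inj bij_is_surj surj_f_inv_f)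

lemma \<iota>_inject [simp]: "\<iota> x = \<iota> y \<longleftrightarrow> x = y" and linear_\<iota>: "linear \<iota>"
  using ideal by (auto simp: left_ideal_embedding_def inj_eq)

lemma \<iota>_mult [simp]: "\<iota> (ideal_mult \<iota> c a) = c * \<iota> a"
  using ideal by (rule \<iota>_ideal_mult)

lemma \<iota>_restrict [simp]: "\<iota> (restrict_to \<iota> f a) = f (\<iota> a)"
  using preserves by (intro \<iota>_restrict_to) simp

lemma inv_preserves: "inv f ` range \<iota> = range \<iota>"
  using preserves bij by (metis bij_is_inj image_inv_f_f)

lemma \<iota>_restrict_inv [simp]: "\<iota> (restrict_to \<iota> (inv f) a) = inv f (\<iota> a)"
  using inv_preserves by (intro \<iota>_restrict_to) simp

text \<open>
  \<open>T\<^sub>t\<close> is \<open>\<Phi>\<^sub>t\<close> followed by a weight, and \<open>S\<^sub>t\<close> is the inverse of \<open>\<Phi>\<^sub>t\<close> followed by a weight; invariance of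
  the locale under inversion makes every fact about the one available for the other.
\<close>

lemma ideal_automorphism_inv: "ideal_automorphism \<iota> (inv f)"
proof
  show "isometric_algebra_iso (inv f)"
    unfolding isometric_algebra_iso_def
  proof (intro conjI allI)
    interpret linear f by (rule linear)
    show "linear (inv f)"
      by (rule linearI; rule injD[OF bij_is_inj[OF bij]]) (simp_all add: add scale)
    show "bij (inv f)" using bij by (rule bij_imp_bij_inv)
    show "inv f (x * y) = inv f x * inv f y" for x y
      by (rule injD[OF bij_is_inj[OF bij]]) (simp add: mult)
    show "norm (inv f x) = norm x" for x
      using iso unfolding isometric_algebra_iso_def by (metis f_inv)
  qed
  show "norm (restrict_to \<iota> (inv f) a) = norm a" for a
  proof -
    have "restrict_to \<iota> f (restrict_to \<iota> (inv f) a) = a"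
      by (subst \<iota>_inject[symmetric]) simp
    then show ?thesis by (metis isometry)
  qed
qed (use ideal norm_ideal_mult inv_preserves in auto)

lemma ideal_mult_mult: "ideal_mult \<iota> (c * d) a = ideal_mult \<iota> c (ideal_mult \<iota> d a)"
  by (subst \<iota>_inject[symmetric]) (simp add: mult.assoc)

lemma restrict_ideal_mult:
  "restrict_to \<iota> f (ideal_mult \<iota> c a) = ideal_mult \<iota> (f c) (restrict_to \<iota> f a)"
  by (subst \<iota>_inject[symmetric]) (simp add: mult)

text \<open>
  The bridge from the limit hypotheses to the operators: for \<open>f = \<Phi>\<^sub>t\<close> and \<open>c = \<Phi>\<^sub>t\<^sup>-\<^sup>1(b\<^sub>t)\<close> the right-hand
  side is \<open>\<parallel>T\<^sub>t a\<parallel>\<close>, and for \<open>f = \<Phi>\<^sub>t\<^sup>-\<^sup>1\<close> and \<open>c = b\<^sub>t\<^sup>-\<^sup>1\<close> it is \<open>\<parallel>S\<^sub>t a\<parallel>\<close>.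
\<close>

lemma norm_twist: "norm (ideal_mult \<iota> c a) = norm (ideal_mult \<iota> (f c) (restrict_to \<iota> f a))"
  using isometry[of "ideal_mult \<iota> c a"] by (simp add: restrict_ideal_mult)

text \<open>
  For \<open>f = \<Phi>\<^sub>t\<close>, \<open>d = \<Phi>\<^sub>t\<^sup>-\<^sup>1(b\<^sub>t)\<close> and \<open>c = \<Phi>\<^sub>t\<^sup>-\<^sup>1(d)\<close> the right-hand side is \<open>\<parallel>T\<^sub>t T\<^sub>t a\<parallel>\<close>; for
  \<open>f = \<Phi>\<^sub>t\<^sup>-\<^sup>1\<close>, \<open>d = b\<^sub>t\<^sup>-\<^sup>1\<close> and \<open>c = \<Phi>\<^sub>t(d)\<close> it is \<open>\<parallel>S\<^sub>t S\<^sub>t a\<parallel>\<close>.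
\<close>

lemma norm_twist_twice:
  "norm (ideal_mult \<iota> (c * d) a)
    = norm (ideal_mult \<iota> (f (f c)) (restrict_to \<iota> f (ideal_mult \<iota> (f d) (restrict_to \<iota> f a))))"
  by (subst norm_twist, subst norm_twist) (simp add: mult ideal_mult_mult restrict_ideal_mult)

lemma bounded_linear_weighted:
  "bounded_linear (\<lambda>a. ideal_mult \<iota> c (restrict_to \<iota> f a))"
proof -
  interpret f: linear f by (rule linear)
  interpret \<iota>: linear \<iota> by (rule linear_\<iota>)
  show ?thesis
  proof (rule bounded_linear_intro[where K = "norm c"])
    fix x y :: 'a and r :: real
    show "ideal_mult \<iota> c (restrict_to \<iota> f (x + y))
        = ideal_mult \<iota> c (restrict_to \<iota> f x) + ideal_mult \<iota> c (restrict_to \<iota> f y)"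
      by (subst \<iota>_inject[symmetric]) (simp add: \<iota>.add f.add distrib_left)
    show "ideal_mult \<iota> c (restrict_to \<iota> f (r *\<^sub>R x)) = r *\<^sub>R ideal_mult \<iota> c (restrict_to \<iota> f x)"
      by (subst \<iota>_inject[symmetric]) (simp add: \<iota>.scale f.scale)
    show "norm (ideal_mult \<iota> c (restrict_to \<iota> f x)) \<le> norm x * norm c"
      using norm_ideal_mult[of c "restrict_to \<iota> f x"] by (simp add: isometry mult.commute)
  qed
qed

end

section \<open>Semi-transitivity of the cosine family\<close>

theorem corollary3p5:
  fixes \<iota> :: "'a::real_normed_algebra \<Rightarrow> 'b::{real_algebra_1, real_normed_algebra}"
    and P :: "'a set"
    and \<Phi> :: "nat \<Rightarrow> 'b \<Rightarrow> 'b"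
    and b b' :: "nat \<Rightarrow> 'b"
    and B1 B2 :: "'a set"
    and n :: "nat \<Rightarrow> nat"
  assumes non_unital: "\<not> (\<exists>e::'a. \<forall>a. e * a = a \<and> a * e = a)"
    and ideal: "left_ideal_embedding \<iota>"
    and norm_ideal_mult: "\<And>c a. norm (ideal_mult \<iota> c a) \<le> norm c * norm a"
    and approx: "\<And>U x. open U \<Longrightarrow> x \<in> U \<Longrightarrow> \<exists>p\<in>P. p * p * p * x \<in> U"
    and iso: "\<And>t. isometric_algebra_iso (\<Phi> t)"
    and preserves: "\<And>t. \<Phi> t ` range \<iota> = range \<iota>"
    and isometry: "\<And>t a. norm (restrict_to \<iota> (\<Phi> t) a) = norm a"
    and aperiodic:
      "aperiodic_wrt {F. infinite F} P (\<lambda>t. restrict_to \<iota> (\<Phi> t)) (\<lambda>t. restrict_to \<iota> (inv (\<Phi> t)))"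
    and norm_p: "\<And>p a. p \<in> P \<Longrightarrow> norm (a * p) \<le> norm a"
    and norm_\<Phi>_p: "\<And>p t a. p \<in> P \<Longrightarrow> norm (a * restrict_to \<iota> (\<Phi> t) p) \<le> norm a"
    and norm_inv_\<Phi>_p: "\<And>p t a. p \<in> P \<Longrightarrow> norm (a * restrict_to \<iota> (inv (\<Phi> t)) p) \<le> norm a"
    and inverse: "\<And>t. b t * b' t = 1 \<and> b' t * b t = 1"
    and dense: "closure B1 = UNIV" "closure B2 = UNIV"
    and subseq: "strict_mono n"
    and limits:
      "(\<forall>x\<in>B1. \<forall>y\<in>B2.
          (\<lambda>k. norm (ideal_mult \<iota>
             (inv (\<Phi> (n k)) (inv (\<Phi> (n k)) (b (n k))) * inv (\<Phi> (n k)) (b (n k))) y))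
            \<longlonglongrightarrow> 0 \<and>
          (\<lambda>k. norm (ideal_mult \<iota> (b' (n k)) x)
             * norm (ideal_mult \<iota> (inv (\<Phi> (n k)) (b (n k))) y)) \<longlonglongrightarrow> 0 \<and>
          (\<lambda>k. norm (ideal_mult \<iota> (inv (\<Phi> (n k)) (b (n k))) x)
             * norm (ideal_mult \<iota> (inv (\<Phi> (n k)) (b (n k))) y)) \<longlonglongrightarrow> 0)
       \<or>
       (\<forall>x\<in>B1. \<forall>y\<in>B2.
          (\<lambda>k. norm (ideal_mult \<iota> (\<Phi> (n k) (b' (n k)) * b' (n k)) y)) \<longlonglongrightarrow> 0 \<and>
          (\<lambda>k. norm (ideal_mult \<iota> (b' (n k)) x)
             * norm (ideal_mult \<iota> (b' (n k)) y)) \<longlonglongrightarrow> 0 \<and>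
          (\<lambda>k. norm (ideal_mult \<iota> (inv (\<Phi> (n k)) (b (n k))) x)
             * norm (ideal_mult \<iota> (b' (n k)) y)) \<longlonglongrightarrow> 0)"
  shows "semi_transitive {F. infinite F} (C_op \<iota> \<Phi> b b')"
proof -
  have auto: "ideal_automorphism \<iota> (\<Phi> t)" for t
    by unfold_locales (use ideal norm_ideal_mult iso preserves isometry in auto)
  note auto_inv = ideal_automorphism.ideal_automorphism_inv[OF auto]
  let ?T = "T_op \<iota> \<Phi> b" and ?S = "S_op \<iota> \<Phi> b'"
  have T_eq: "?T t = (\<lambda>a. ideal_mult \<iota> (b t) (restrict_to \<iota> (\<Phi> t) a))"
    and S_eq: "?S t = (\<lambda>a. ideal_mult \<iota> (inv (\<Phi> t) (b' t)) (restrict_to \<iota> (inv (\<Phi> t)) a))" for t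
    by (auto simp: T_op_def S_op_def)
  have T: "bounded_linear (?T t)" and S: "bounded_linear (?S t)" for t
    unfolding T_eq S_eq
    by (rule ideal_automorphism.bounded_linear_weighted[OF auto]
             ideal_automorphism.bounded_linear_weighted[OF auto_inv])+
  have ST: "?S t (?T t x) = x" and TS: "?T t (?S t x) = x" for t x
  proof -
    interpret ideal_automorphism \<iota> "\<Phi> t" by (rule auto)
    interpret inv: ideal_automorphism \<iota> "inv (\<Phi> t)" by (rule auto_inv)
    have "inv (\<Phi> t) (b' t) * inv (\<Phi> t) (b t) = 1" "\<Phi> t 1 = 1"
    proof -
      have "\<Phi> t 1 = \<Phi> t 1 * \<Phi> t (inv (\<Phi> t) 1)" by simp
      also have "\<dots> = 1" by (simp only: mult[symmetric]) simp
      finally show "\<Phi> t 1 = 1" .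
      then have "inv (\<Phi> t) 1 = 1" by (metis inv_f)
      then show "inv (\<Phi> t) (b' t) * inv (\<Phi> t) (b t) = 1"
        using inverse by (simp add: inv.mult[symmetric])
    qed
    then show "?S t (?T t x) = x" "?T t (?S t x) = x"
      unfolding T_eq S_eq using inverse
      by (subst \<iota>_inject[symmetric], simp add: mult inv.mult mult.assoc[symmetric])+
  qed
  have norms:
    "norm (ideal_mult \<iota> (inv (\<Phi> t) (b t)) x) = norm (?T t x)"
    "norm (ideal_mult \<iota> (b' t) x) = norm (?S t x)"
    "norm (ideal_mult \<iota> (inv (\<Phi> t) (inv (\<Phi> t) (b t)) * inv (\<Phi> t) (b t)) x) = norm (?T t (?T t x))"
    "norm (ideal_mult \<iota> (\<Phi> t (b' t) * b' t) x) = norm (?S t (?S t x))" for t x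
  proof -
    interpret ideal_automorphism \<iota> "\<Phi> t" by (rule auto)
    interpret inv: ideal_automorphism \<iota> "inv (\<Phi> t)" by (rule auto_inv)
    show "norm (ideal_mult \<iota> (inv (\<Phi> t) (b t)) x) = norm (?T t x)"
      by (subst norm_twist) (simp add: T_eq)
    show "norm (ideal_mult \<iota> (b' t) x) = norm (?S t x)"
      by (subst inv.norm_twist) (simp add: S_eq)
    show "norm (ideal_mult \<iota> (inv (\<Phi> t) (inv (\<Phi> t) (b t)) * inv (\<Phi> t) (b t)) x)
        = norm (?T t (?T t x))"
      by (subst norm_twist_twice) (simp add: T_eq)
    show "norm (ideal_mult \<iota> (\<Phi> t (b' t) * b' t) x) = norm (?S t (?S t x))"
      by (subst inv.norm_twist_twice) (simp add: S_eq)
  qed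
  have C_eq: "C_op \<iota> \<Phi> b b' = (\<lambda>t a. (1/2) *\<^sub>R (?T t a + ?S t a))"
    and C_eq': "C_op \<iota> \<Phi> b b' = (\<lambda>t a. (1/2) *\<^sub>R (?S t a + ?T t a))"
    by (auto simp: fun_eq_iff C_op_def add.commute)
  \<comment> \<open>The vanishing of \<open>T\<^sub>t T\<^sub>t y\<close> is stated under \<open>x \<in> B1\<close>, so a point of \<open>B1\<close> must be supplied.\<close>
  have "B1 \<noteq> {}" using dense(1) by auto
  from limits show ?thesis
    unfolding norms
  proof
    assume "\<forall>x\<in>B1. \<forall>y\<in>B2.
      (\<lambda>k. norm (?T (n k) (?T (n k) y))) \<longlonglongrightarrow> 0 \<and>
      (\<lambda>k. norm (?S (n k) x) * norm (?T (n k) y)) \<longlonglongrightarrow> 0 \<and>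
      (\<lambda>k. norm (?T (n k) x) * norm (?T (n k) y)) \<longlonglongrightarrow> 0"
    with \<open>B1 \<noteq> {}\<close> show ?thesis
      unfolding C_eq by (intro semi_transitive_average[OF T S ST dense subseq]) auto
  next
    assume "\<forall>x\<in>B1. \<forall>y\<in>B2.
      (\<lambda>k. norm (?S (n k) (?S (n k) y))) \<longlonglongrightarrow> 0 \<and>
      (\<lambda>k. norm (?S (n k) x) * norm (?S (n k) y)) \<longlonglongrightarrow> 0 \<and>
      (\<lambda>k. norm (?T (n k) x) * norm (?S (n k) y)) \<longlonglongrightarrow> 0"
    with \<open>B1 \<noteq> {}\<close> show ?thesis
      unfolding C_eq' by (intro semi_transitive_average[OF S T TS dense subseq]) auto
  qed
qed

end
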